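(* Let $D$ be a digraph on $\{1,\dots,n\}$, $q\ge2$, $f\in F[D,q]$ and $\sigma$ a block-sequential schedule. Then $\operatorname{ima}(f^\sigma)\le\alpha_1(D)$.
   Context: A digraph $D=(V,E)$ has $V=\{1,\dots,n\}$, $E\subseteq V^2$ (loops allowed). $\alpha_1(D)$ is the maximum number of pairwise independent arcs, where arcs $(u,v),(u',v')$ are independent if $u\ne u'$ and $v\ne v'$. With $[q]=\{0,\dots,q-1\}$, for $f:[q]^n\to[q]^n$, $\mathrm{IG}(f)$ is the digraph on $V$ with $(u,v)$ an arc iff $f_v$ depends essentially on $x_u$; $F[D,q]=\{f:\mathrm{IG}(f)=D\}$. A schedule is a sequence $\sigma=(\sigma_1,\dots,\sigma_t)$ of subsets of $V$. For $S\subseteq V$, $f^{(S)}:[q]^n\to[q]^n$ is given by $f^{(S)}_v(x)=f_v(x)$ if $v\in S$ and $f^{(S)}_v(x)=x_v$ otherwise; $f^\sigma=f^{(\sigma_t)}\circ\dots\circ f^{(\sigma_1)}$. $\sigma$ is block-sequential if $\bigcup_i\sigma_i=V$ and $\sigma_i\cap\sigma_j=\emptyset$ for $i\ne j$. $\operatorname{ima}(g)=\log_q|\mathrm{Im}(g)|$. *)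

theory Defs
  imports Complex_Main "HOL-Library.FuncSet" "Graph_Theory.Pair_Digraph"
begin

(* The set [q]^n. Its elements are extensional functions, so that distinct elements
   differ at some vertex in {1..n} and cardinalities are the intended ones. *)
definition configs :: "nat \<Rightarrow> nat \<Rightarrow> (nat \<Rightarrow> nat) set" where
  "configs n q = {1..n} \<rightarrow>\<^sub>E {0..<q}"

definition depends_on ::
  "nat \<Rightarrow> nat \<Rightarrow> ((nat \<Rightarrow> nat) \<Rightarrow> nat \<Rightarrow> nat) \<Rightarrow> nat \<Rightarrow> nat \<Rightarrow> bool" where
  "depends_on n q f v u \<longleftrightarrow>
     (\<exists>x \<in> configs n q. \<exists>y \<in> configs n q. (\<forall>w \<in> {1..n} - {u}. x w = y w) \<and> f x v \<noteq> f y v)"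

definition interaction_graph ::
  "nat \<Rightarrow> nat \<Rightarrow> ((nat \<Rightarrow> nat) \<Rightarrow> nat \<Rightarrow> nat) \<Rightarrow> nat pair_pre_digraph" where
  "interaction_graph n q f =
     \<lparr> pverts = {1..n}, parcs = {(u, v). u \<in> {1..n} \<and> v \<in> {1..n} \<and> depends_on n q f v u} \<rparr>"

(* F[D,q] for a digraph D on {1..n}. A map from [q]^n to itself is represented by any total
   function mapping configs n q into itself; its values elsewhere are never used. *)
definition networks ::
  "nat \<Rightarrow> nat pair_pre_digraph \<Rightarrow> nat \<Rightarrow> ((nat \<Rightarrow> nat) \<Rightarrow> nat \<Rightarrow> nat) set" where
  "networks n D q = {f \<in> configs n q \<rightarrow> configs n q. interaction_graph n q f = D}"

definition indep_arcs :: "'a \<times> 'a \<Rightarrow> 'a \<times> 'a \<Rightarrow> bool" where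
  "indep_arcs a b \<longleftrightarrow> fst a \<noteq> fst b \<and> snd a \<noteq> snd b"

definition alpha1 :: "'a pair_pre_digraph \<Rightarrow> nat" where
  "alpha1 D = Max {card A | A. A \<subseteq> parcs D \<and> pairwise indep_arcs A}"

definition block_update ::
  "((nat \<Rightarrow> nat) \<Rightarrow> nat \<Rightarrow> nat) \<Rightarrow> nat set \<Rightarrow> (nat \<Rightarrow> nat) \<Rightarrow> nat \<Rightarrow> nat" where
  "block_update f S x = (\<lambda>v. if v \<in> S then f x v else x v)"

(* The head of the list is applied first. *)
definition schedule_update ::
  "((nat \<Rightarrow> nat) \<Rightarrow> nat \<Rightarrow> nat) \<Rightarrow> nat set list \<Rightarrow> (nat \<Rightarrow> nat) \<Rightarrow> nat \<Rightarrow> nat" where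
  "schedule_update f \<sigma> = fold (block_update f) \<sigma>"

definition schedule :: "nat \<Rightarrow> nat set list \<Rightarrow> bool" where
  "schedule n \<sigma> \<longleftrightarrow> (\<forall>S \<in> set \<sigma>. S \<subseteq> {1..n})"

definition block_sequential :: "nat \<Rightarrow> nat set list \<Rightarrow> bool" where
  "block_sequential n \<sigma> \<longleftrightarrow>
     schedule n \<sigma> \<and> \<Union> (set \<sigma>) = {1..n} \<and>
     (\<forall>i < length \<sigma>. \<forall>j < length \<sigma>. i \<noteq> j \<longrightarrow> \<sigma> ! i \<inter> \<sigma> ! j = {})"

definition ima :: "nat \<Rightarrow> nat \<Rightarrow> ((nat \<Rightarrow> nat) \<Rightarrow> nat \<Rightarrow> nat) \<Rightarrow> real" where
  "ima n q g = log (real q) (real (card (g ` configs n q)))"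

end

theory Submission
  imports Defs
begin

text \<open>By Koenig's theorem for the bipartite double cover of \<open>D\<close>, some sets \<open>A\<close>, \<open>B\<close> of vertices with
  \<open>card A + card B \<le> alpha1 D\<close> are such that every arc has its tail in \<open>A\<close> or its head in \<open>B\<close>. Then
  \<open>y = f\<^sup>\<sigma>(x)\<close> is determined by \<open>x\<close> on \<open>A\<close> and \<open>y\<close> on \<open>B\<close>: going through the blocks in order, the new
  value at \<open>v \<notin> B\<close> only depends on the current state on \<open>A\<close>, and the new value at \<open>v \<in> B\<close> is final,
  hence equal to \<open>y v\<close>. Koenig's theorem is proved by uncrossing: in an arc set whose minimum cover
  size drops on removing any arc, the union and intersection of the covers for two arcs with a common
  endpoint would give too small a cover, so such a set is already a matching.\<close>

section \<open>Vertex covers of arc sets and Koenig's theorem\<close>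

text \<open>A vertex cover of the bipartite double cover, \<open>A\<close> on the tail side and
  \<open>B\<close> on the head side. Finiteness is demanded because \<open>card\<close> is 0 on
  infinite sets, which would make them free covers.\<close>

definition arc_cover :: "('a \<times> 'a) set \<Rightarrow> 'a set \<Rightarrow> 'a set \<Rightarrow> bool" where
  "arc_cover R A B \<longleftrightarrow> finite A \<and> finite B \<and> (\<forall>u v. (u, v) \<in> R \<longrightarrow> u \<in> A \<or> v \<in> B)"

lemma arc_cover_converse: "arc_cover (R\<inverse>) B A \<longleftrightarrow> arc_cover R A B"
  unfolding arc_cover_def by auto

text \<open>A cover containing \<open>u\<close> on the tail side also covers the deleted arc.
  Otherwise uncrossing the two covers yields two covers of \<open>R\<close> whose total size exceeds
  that of the given ones by at most 1, the cost of adding \<open>u\<close>.\<close>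

lemma arc_cover_shared_tail:
  assumes uv: "(u, v) \<in> R" and uw: "(u, w) \<in> R" and "v \<noteq> w"
    and cover1: "arc_cover (R - {(u, v)}) A1 B1" and card1: "card A1 + card B1 < k"
    and cover2: "arc_cover (R - {(u, w)}) A2 B2" and card2: "card A2 + card B2 < k"
  shows "\<exists>A B. arc_cover R A B \<and> card A + card B < k"
proof (cases "u \<in> A1 \<or> u \<in> A2")
  case True
  then have "arc_cover R A1 B1 \<or> arc_cover R A2 B2"
    using cover1 cover2 unfolding arc_cover_def by blast
  then show ?thesis
    using card1 card2 by blast
next
  case False
  have fin: "finite A1" "finite A2" "finite B1" "finite B2"
    using cover1 cover2 by (auto simp: arc_cover_def)
  have w: "w \<in> B1" and v: "v \<in> B2"
    using False uv uw \<open>v \<noteq> w\<close> cover1 cover2 unfolding arc_cover_def by blast+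
  have meet: "arc_cover R (A1 \<inter> A2) (B1 \<union> B2)"
    using v w cover1 cover2 unfolding arc_cover_def by blast
  have join: "arc_cover R (insert u (A1 \<union> A2)) (B1 \<inter> B2)"
    using cover1 cover2 unfolding arc_cover_def by blast
  have "card (insert u (A1 \<union> A2)) \<le> Suc (card (A1 \<union> A2))"
    by (rule card_insert_le_m1) auto
  moreover have "card (A1 \<union> A2) + card (A1 \<inter> A2) = card A1 + card A2"
    using fin by (metis card_Un_Int)
  moreover have "card (B1 \<union> B2) + card (B1 \<inter> B2) = card B1 + card B2"
    using fin by (metis card_Un_Int)
  \<comment> \<open>The two sizes sum to at most 2(k - 1) + 1 = 2k - 1, so they cannot both reach
    \<open>k\<close>.\<close>
  ultimately have "card (A1 \<inter> A2) + card (B1 \<union> B2) < k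
      \<or> card (insert u (A1 \<union> A2)) + card (B1 \<inter> B2) < k"
    using card1 card2 by linarith
  then show ?thesis
    using meet join by blast
qed

lemma indep_arcs_if_arc_cover_critical:
  assumes critical: "\<And>a. a \<in> R \<Longrightarrow> \<exists>A B. arc_cover (R - {a}) A B \<and> card A + card B < k"
    and bound: "\<And>A B. arc_cover R A B \<Longrightarrow> k \<le> card A + card B"
  shows "pairwise indep_arcs R"
proof (rule pairwiseI)
  fix a b assume "a \<in> R" "b \<in> R" "a \<noteq> b"
  obtain u v u' v' where ab: "a = (u, v)" "b = (u', v')"
    by (metis surj_pair)
  obtain A1 B1 where 1: "arc_cover (R - {(u, v)}) A1 B1" "card A1 + card B1 < k"
    using critical \<open>a \<in> R\<close> ab by blast
  obtain A2 B2 where 2: "arc_cover (R - {(u', v')}) A2 B2" "card A2 + card B2 < k"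
    using critical \<open>b \<in> R\<close> ab by blast
  have "u \<noteq> u'"
  proof
    assume "u = u'"
    then have "\<exists>A B. arc_cover R A B \<and> card A + card B < k"
      using arc_cover_shared_tail[of u v R v'] 1 2 ab \<open>a \<in> R\<close> \<open>b \<in> R\<close> \<open>a \<noteq> b\<close> by blast
    then show False
      using bound by (meson leD)
  qed
  moreover have "v \<noteq> v'"
  proof
    assume "v = v'"
    \<comment> \<open>Reversing all arcs turns the shared head into a shared tail and swaps the two
      sides of each cover.\<close>
    have "(R - {(u, v)})\<inverse> = R\<inverse> - {(v, u)}" "(R - {(u', v')})\<inverse> = R\<inverse> - {(v', u')}"
      by auto
    then have "arc_cover (R\<inverse> - {(v, u)}) B1 A1" "arc_cover (R\<inverse> - {(v', u')}) B2 A2"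
      using 1(1) 2(1) by (metis arc_cover_converse)+
    then have "\<exists>B A. arc_cover (R\<inverse>) B A \<and> card B + card A < k"
      using arc_cover_shared_tail[of v u "R\<inverse>" u' B1 A1 k B2 A2]
        1(2) 2(2) ab \<open>a \<in> R\<close> \<open>b \<in> R\<close> \<open>a \<noteq> b\<close> \<open>v = v'\<close> by (simp add: add.commute)
    then show False
      using bound by (metis add.commute arc_cover_converse leD)
  qed
  ultimately show "indep_arcs a b"
    by (simp add: indep_arcs_def ab)
qed

text \<open>Delete arcs as long as every cover keeps size at least \<open>k\<close>. Once no
  deletion is possible, the arc set is critical and hence a matching.\<close>

lemma koenig:
  assumes "finite R" and "\<And>A B. arc_cover R A B \<Longrightarrow> k \<le> card A + card B"
  shows "\<exists>M \<subseteq> R. pairwise indep_arcs M \<and> k \<le> card M"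
  using assms
proof (induction R rule: finite_psubset_induct)
  case (psubset R)
  show ?case
  proof (cases "\<exists>a \<in> R. \<forall>A B. arc_cover (R - {a}) A B \<longrightarrow> k \<le> card A + card B")
    case True
    then obtain a where "a \<in> R" "\<And>A B. arc_cover (R - {a}) A B \<Longrightarrow> k \<le> card A + card B"
      by blast
    then obtain M where "M \<subseteq> R - {a}" "pairwise indep_arcs M" "k \<le> card M"
      using psubset.IH[of "R - {a}"] by blast
    then show ?thesis
      by blast
  next
    case False
    then have "\<exists>A B. arc_cover (R - {a}) A B \<and> card A + card B < k" if "a \<in> R" for a
      using that by (meson not_le)
    then have "pairwise indep_arcs R"
      using psubset.prems by (rule indep_arcs_if_arc_cover_critical)
    \<comment> \<open>The set of all tails is a cover, so its size, and with it the number of arcs,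
      is at least \<open>k\<close>.\<close>
    moreover have "arc_cover R (fst ` R) {}"
      using psubset.hyps by (force simp: arc_cover_def)
    then have "k \<le> card (fst ` R)"
      using psubset.prems by (metis add_0_right card.empty)
    then have "k \<le> card R"
      using card_image_le[OF psubset.hyps, of fst] by linarith
    ultimately show ?thesis
      by blast
  qed
qed

lemma card_le_alpha1:
  assumes "finite (parcs D)" "M \<subseteq> parcs D" "pairwise indep_arcs M"
  shows "card M \<le> alpha1 D"
  unfolding alpha1_def
proof (rule Max_ge)
  have "{card A |A. A \<subseteq> parcs D \<and> pairwise indep_arcs A} \<subseteq> card ` Pow (parcs D)"
    by blast
  then show "finite {card A |A. A \<subseteq> parcs D \<and> pairwise indep_arcs A}"
    using assms(1) by (meson finite_Pow_iff finite_imageI finite_subset)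
qed (use assms in blast)

text \<open>Were all covers larger, Koenig's theorem with \<open>k = Suc (alpha1 D)\<close> would
  give too many independent arcs.\<close>

lemma ex_arc_cover_alpha1:
  assumes "finite (parcs D)"
  shows "\<exists>A B. arc_cover (parcs D) A B \<and> card A + card B \<le> alpha1 D"
proof (rule ccontr)
  assume none: "\<not> ?thesis"
  have "Suc (alpha1 D) \<le> card A + card B" if "arc_cover (parcs D) A B" for A B
    using none that not_less_eq_eq by blast
  then obtain M where "M \<subseteq> parcs D" "pairwise indep_arcs M" "Suc (alpha1 D) \<le> card M"
    using koenig[OF assms] by meson
  then show False
    using card_le_alpha1[OF assms, of M] by simp
qed

section \<open>Configurations and essential dependence\<close>

lemma configs_eqI:
  assumes "x \<in> configs n q" "y \<in> configs n q" "\<And>v. v \<in> {1..n} \<Longrightarrow> x v = y v"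
  shows "x = y"
  using assms unfolding configs_def by (rule PiE_ext)

lemma configs_fun_upd:
  assumes "x \<in> configs n q" "y \<in> configs n q" "u \<in> {1..n}"
  shows "x(u := y u) \<in> configs n q"
  using assms unfolding configs_def by (auto simp: PiE_iff extensional_def)

text \<open>Change the coordinates where the two configurations differ one at a time.\<close>

lemma local_function_cong:
  assumes "x \<in> configs n q" "y \<in> configs n q"
    and "\<And>u. u \<in> {1..n} \<Longrightarrow> depends_on n q f v u \<Longrightarrow> x u = y u"
  shows "f x v = f y v"
  using assms
proof (induction "card {u \<in> {1..n}. x u \<noteq> y u}" arbitrary: x)
  case 0
  then have "x = y"
    by (intro configs_eqI) auto
  then show ?case
    by simp
next
  case (Suc k)
  then have "{u \<in> {1..n}. x u \<noteq> y u} \<noteq> {}"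
    by (metis card.empty nat.distinct(1))
  then obtain u where u: "u \<in> {1..n}" "x u \<noteq> y u"
    by blast
  define z where "z = x(u := y u)"
  have z: "z \<in> configs n q"
    unfolding z_def using Suc.prems u by (intro configs_fun_upd)
  have "{w \<in> {1..n}. z w \<noteq> y w} = {w \<in> {1..n}. x w \<noteq> y w} - {u}"
    by (auto simp: z_def)
  then have "k = card {w \<in> {1..n}. z w \<noteq> y w}"
    using Suc.hyps(2) u by simp
  then have "f z v = f y v"
    using Suc.hyps(1) z Suc.prems by (simp add: z_def)
  moreover have "\<not> depends_on n q f v u"
    using Suc.prems(3) u by blast
  then have "f x v = f z v"
    using Suc.prems(1) z unfolding depends_on_def z_def by fastforce
  ultimately show ?case
    by simp
qed

section \<open>Running a schedule block by block\<close>

lemma block_update_in_configs: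
  assumes "f \<in> configs n q \<rightarrow> configs n q" "x \<in> configs n q"
  shows "block_update f S x \<in> configs n q"
proof -
  have "f x \<in> configs n q"
    using assms by blast
  then show ?thesis
    using assms(2) unfolding configs_def block_update_def by (auto simp: PiE_iff extensional_def)
qed

lemma fold_block_update_in_configs:
  assumes "f \<in> configs n q \<rightarrow> configs n q" "x \<in> configs n q"
  shows "fold (block_update f) \<sigma> x \<in> configs n q"
  using assms(2) by (induction \<sigma> arbitrary: x) (auto intro: block_update_in_configs[OF assms(1)])

lemma fold_block_update_unchanged:
  assumes "v \<notin> \<Union> (set \<sigma>)"
  shows "fold (block_update f) \<sigma> x v = x v"
  using assms by (induction \<sigma> arbitrary: x) (auto simp: block_update_def)

text \<open>Induction over the remaining blocks. \<open>C\<close> collects vertices where the two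
  runs currently agree; it grows by each processed block and always contains
  \<open>A\<close>.\<close>

lemma fold_block_update_determined:
  assumes f: "f \<in> configs n q \<rightarrow> configs n q"
    and cover: "arc_cover (parcs (interaction_graph n q f)) A B"
    and "sorted_wrt disjnt \<sigma>" "\<Union> (set \<sigma>) \<subseteq> {1..n}" "A \<subseteq> C"
    and "x \<in> configs n q" "x' \<in> configs n q"
    and "\<And>u. u \<in> C \<Longrightarrow> x u = x' u"
    and "\<And>v. v \<in> B \<Longrightarrow> fold (block_update f) \<sigma> x v = fold (block_update f) \<sigma> x' v"
    and "v \<in> C \<union> \<Union> (set \<sigma>)"
  shows "fold (block_update f) \<sigma> x v = fold (block_update f) \<sigma> x' v"
  using assms(3-)
proof (induction \<sigma> arbitrary: x x' C)
  case Nil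
  then show ?case
    by simp
next
  case (Cons S \<sigma>)
  let ?z = "block_update f S x" and ?z' = "block_update f S x'"
  have agree: "?z w = ?z' w" if "w \<in> C \<union> S" for w
  proof (cases "w \<in> S")
    case True
    show ?thesis
    proof (cases "w \<in> B")
      case True
      \<comment> \<open>No later block touches \<open>w\<close>, so its new value is final, and the
        final values agree on \<open>B\<close>.\<close>
      have "w \<notin> \<Union> (set \<sigma>)"
        using \<open>w \<in> S\<close> Cons.prems(1) by (auto simp: disjnt_def)
      then show ?thesis
        using Cons.prems(7)[OF True] by (simp add: fold_block_update_unchanged)
    next
      case False
      have "w \<in> {1..n}"
        using \<open>w \<in> S\<close> Cons.prems(2) by auto
      \<comment> \<open>Since \<open>w\<close> is not in \<open>B\<close>, the cover forces all
        in-neighbours of \<open>w\<close> into \<open>A\<close>, where the current states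
        agree.\<close>
      have "u \<in> A" if "u \<in> {1..n}" "depends_on n q f w u" for u
      proof -
        have "(u, w) \<in> parcs (interaction_graph n q f)"
          using that \<open>w \<in> {1..n}\<close> by (simp add: interaction_graph_def)
        then show ?thesis
          using cover False unfolding arc_cover_def by blast
      qed
      then have "f x w = f x' w"
        using Cons.prems(3,6) by (intro local_function_cong[where f = f, OF Cons.prems(4,5)]) blast
      then show ?thesis
        using \<open>w \<in> S\<close> by (simp add: block_update_def)
    qed
  next
    case False
    then show ?thesis
      using that Cons.prems(6) by (simp add: block_update_def)
  qed
  have "fold (block_update f) \<sigma> ?z v = fold (block_update f) \<sigma> ?z' v"
  proof (rule Cons.IH[of "C \<union> S"])
    show "sorted_wrt disjnt \<sigma>" "\<Union> (set \<sigma>) \<subseteq> {1..n}" "A \<subseteq> C \<union> S" "v \<in> (C \<union> S) \<union> \<Union> (set \<sigma>)"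
      using Cons.prems(1-3,8) by auto
    show "?z \<in> configs n q" "?z' \<in> configs n q"
      using Cons.prems(4,5) by (simp_all add: block_update_in_configs[OF f])
    show "fold (block_update f) \<sigma> ?z w = fold (block_update f) \<sigma> ?z' w" if "w \<in> B" for w
      using Cons.prems(7)[OF that] by simp
  qed (rule agree)
  then show ?case
    by simp
qed

text \<open>Replaces disjointness by index with a form that splits along head and tail, as induction
  over the list requires.\<close>

lemma block_sequential_sorted_wrt_disjnt:
  assumes "block_sequential n \<sigma>"
  shows "sorted_wrt disjnt \<sigma>"
  unfolding sorted_wrt_iff_nth_less disjnt_def
proof (intro allI impI)
  fix i j assume "i < j" "j < length \<sigma>"
  then show "\<sigma> ! i \<inter> \<sigma> ! j = {}"
    using assms unfolding block_sequential_def by (metis less_trans less_not_refl)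
qed

section \<open>Counting the image of the schedule\<close>

text \<open>On \<open>X\<close>, \<open>g\<close> factors through \<open>h\<close>: choosing a
  preimage under \<open>h\<close> and applying \<open>g\<close> maps \<open>T\<close> onto a
  superset of the image of \<open>g\<close>.\<close>

lemma card_image_le_if_determined:
  assumes "finite T" "h ` X \<subseteq> T"
    and "\<And>x y. x \<in> X \<Longrightarrow> y \<in> X \<Longrightarrow> h x = h y \<Longrightarrow> g x = g y"
  shows "card (g ` X) \<le> card T"
proof -
  have "g x = g (inv_into X h (h x))" if "x \<in> X" for x
    using assms(3) that by (metis f_inv_into_f imageI inv_into_into)
  then have "g ` X = (\<lambda>t. g (inv_into X h t)) ` h ` X"
    by (force simp: image_image)
  then have "g ` X \<subseteq> (\<lambda>t. g (inv_into X h t)) ` T"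
    using assms(2) by blast
  then show ?thesis
    by (rule surj_card_le[OF assms(1)])
qed

lemma card_image_schedule_update_le:
  assumes "f \<in> configs n q \<rightarrow> configs n q" and "block_sequential n \<sigma>"
    and "arc_cover (parcs (interaction_graph n q f)) A B" and "A \<subseteq> {1..n}" "B \<subseteq> {1..n}"
  shows "card (schedule_update f \<sigma> ` configs n q) \<le> q ^ (card A + card B)"
proof -
  let ?g = "schedule_update f \<sigma>"
  let ?T = "(A \<rightarrow>\<^sub>E {0..<q}) \<times> (B \<rightarrow>\<^sub>E {0..<q})"
  \<comment> \<open>The code of \<open>x\<close> reads \<open>A\<close> from the initial
    configuration but \<open>B\<close> from the final one.\<close>
  define h where "h = (\<lambda>x. (restrict x A, restrict (?g x) B))"
  have g: "?g x \<in> configs n q" if "x \<in> configs n q" for x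
    using fold_block_update_in_configs[OF assms(1) that] by (simp add: schedule_update_def)
  have restr: "restrict x S \<in> S \<rightarrow>\<^sub>E {0..<q}" if "x \<in> configs n q" "S \<subseteq> {1..n}" for x S
    using that by (fastforce simp: configs_def PiE_iff)
  have fin: "finite A" "finite B"
    using assms(3) by (auto simp: arc_cover_def)
  have "card (?g ` configs n q) \<le> card ?T"
  proof (rule card_image_le_if_determined)
    show "finite ?T"
      using fin by (intro finite_cartesian_product finite_PiE) auto
    show "h ` configs n q \<subseteq> ?T"
      using g restr assms(4,5) by (simp add: h_def image_subset_iff del: PiE_iff)
    fix x y assume xy: "x \<in> configs n q" "y \<in> configs n q" "h x = h y"
    have A: "x u = y u" if "u \<in> A" for u
      using xy(3) that unfolding h_def by (metis Pair_inject restrict_apply')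
    have B: "?g x u = ?g y u" if "u \<in> B" for u
      using xy(3) that unfolding h_def by (metis Pair_inject restrict_apply')
    have union: "\<Union> (set \<sigma>) = {1..n}"
      using assms(2) by (simp add: block_sequential_def)
    show "?g x = ?g y"
    proof (rule configs_eqI[OF g g])
      fix v assume "v \<in> {1..n}"
      \<comment> \<open>The agreement set starts as \<open>C = A\<close>; the blocks exhaust
        \<open>{1..n}\<close>, so every vertex is reached.\<close>
      then show "?g x v = ?g y v"
        unfolding schedule_update_def
        using fold_block_update_determined[OF assms(1,3) block_sequential_sorted_wrt_disjnt[OF assms(2)],
            of A x y v] A B union xy
        by (simp add: schedule_update_def)
    qed (use xy in auto)
  qed
  also have "card ?T = q ^ (card A + card B)"
    using fin by (simp add: card_cartesian_product card_PiE power_add)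
  finally show ?thesis .
qed

theorem theorem5:
  fixes n q :: nat
    and D :: "nat pair_pre_digraph"
    and f :: "(nat \<Rightarrow> nat) \<Rightarrow> nat \<Rightarrow> nat"
    and \<sigma> :: "nat set list"
  assumes "pair_wf_digraph D"
    and "pverts D = {1..n}"
    and "q \<ge> 2"
    and "f \<in> networks n D q"
    and "block_sequential n \<sigma>"
  shows "ima n q (schedule_update f \<sigma>) \<le> real (alpha1 D)"
proof -
  let ?I = "schedule_update f \<sigma> ` configs n q"
  have f: "f \<in> configs n q \<rightarrow> configs n q" and D: "interaction_graph n q f = D"
    using assms(4) by (auto simp: networks_def)
  have sub: "parcs D \<subseteq> {1..n} \<times> {1..n}"
    unfolding D[symmetric] by (auto simp: interaction_graph_def)
  then have "finite (parcs D)"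
    by (rule finite_subset) simp
  then obtain A B where cover: "arc_cover (parcs D) A B" and AB: "card A + card B \<le> alpha1 D"
    using ex_arc_cover_alpha1 by blast
  \<comment> \<open>The cover may contain numbers outside \<open>{1..n}\<close>; they meet no arc,
    and dropping them does not increase the size.\<close>
  let ?A = "A \<inter> {1..n}" and ?B = "B \<inter> {1..n}"
  have "arc_cover (parcs D) ?A ?B"
    using cover sub unfolding arc_cover_def by blast
  then have "card ?I \<le> q ^ (card ?A + card ?B)"
    using card_image_schedule_update_le[OF f assms(5)] D by simp
  also have "\<dots> \<le> q ^ alpha1 D"
  proof (rule power_increasing)
    have "card ?A \<le> card A" "card ?B \<le> card B"
      using cover by (auto simp: arc_cover_def intro: card_mono)
    then show "card ?A + card ?B \<le> alpha1 D"
      using AB by linarith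
  qed (use assms(3) in simp)
  finally have le: "card ?I \<le> q ^ alpha1 D" .
  \<comment> \<open>A nonempty finite image has positive cardinality, so its logarithm can be
    compared by monotonicity.\<close>
  have "finite (configs n q)" "configs n q \<noteq> {}"
    using assms(3) by (auto simp: configs_def PiE_eq_empty_iff intro: finite_PiE)
  then have "0 < card ?I"
    by (simp add: card_gt_0_iff)
  then have "log q (card ?I) \<le> log q (q ^ alpha1 D)"
    using le assms(3) by (subst log_le_cancel_iff) (auto simp del: of_nat_power)
  also have "\<dots> = alpha1 D"
    using assms(3) by (simp add: log_nat_power)
  finally show ?thesis
    by (simp add: ima_def)
qed

end
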